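(* Let $N>0$ and $\lambda\geq \frac{2N^2}{(1+N)(1+3N)}$ be real numbers. Consider the nearest-neighbor random walk (Markov chain) on $\Omega=\{0,1,2,\dots\}$ with the tridiagonal transition probability operator $$P_\lambda=\begin{pmatrix}r_0^\lambda & p_0^\lambda & 0 & 0 & \cdots\\ q_1^\lambda & r_1^\lambda & p_1^\lambda & 0 & \cdots\\ 0 & q_2^\lambda & r_2^\lambda & p_2^\lambda & \cdots\\ \vdots & \vdots & \ddots & \ddots & \ddots \end{pmatrix},$$ where, for $n\geq 1$, $$p_n^\lambda=\frac{1}{2(1+\lambda)}\cdot\frac{1+(2n-1)N}{1+(2n+1)N},\qquad q_n^\lambda=\frac{1}{2(1+\lambda)}\cdot\frac{1+(2n+1)N}{1+(2n-1)N},\qquad r_n^\lambda=1-p_n^\lambda-q_n^\lambda,$$ and $p_0^\lambda=\frac{1}{(1+\lambda)(N+1)}=1-r_0^\lambda$. Let $\nu$ be the stationary probability distribution of $P_\lambda$ and, for a starting site $j\in\Omega$, let $\mu_t$ be the distribution at time $t$ of the walk started at $j$. Then for every $j\in\Omega$ there are positive constants $c$ and $C$, depending on $j$, $N$ and $\lambda$, such that $$\frac{c}{\sqrt{t}}\leq \left\|\nu-\mu_t\right\|_{TV}\leq C\,\frac{\log t}{\sqrt{t}}$$ for all sufficiently large integers $t$.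
   Context: Here the $(n,n-1)$, $(n,n)$ and $(n,n+1)$ entries of $P_\lambda$ are $q_n^\lambda$ (for $n\ge 1$), $r_n^\lambda$ and $p_n^\lambda$ respectively; all other entries are $0$. The distribution at time $t\in\{0,1,2,\dots\}$ of the chain started at $j$ is $\mu_t=\mu_0P_\lambda^t$ with $\mu_0$ the unit mass at $j$, i.e. $\mu_t(n)=(P_\lambda^t)(j,n)$. A stationary probability distribution is a probability distribution $\nu$ on $\Omega$ with $\nu P_\lambda=\nu$. The total variation distance between probability distributions $\mu,\nu$ on $\Omega$ is $\|\nu-\mu\|_{TV}=\frac12\sum_{x\in\Omega}|\nu(x)-\mu(x)|=\sup_{A\subset\Omega}|\nu(A)-\mu(A)|$. *)

theory Defs
  imports "HOL-Probability.Probability"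
begin

definition up_prob :: "real \<Rightarrow> real \<Rightarrow> nat \<Rightarrow> real" where
  "up_prob N l n =
     (if n = 0 then 1 / ((1 + l) * (N + 1))
      else 1 / (2 * (1 + l)) * ((1 + (2 * real n - 1) * N) / (1 + (2 * real n + 1) * N)))"

text \<open>Only the values at \<open>n \<ge> 1\<close> of the following function occur in the transition operator.\<close>

definition down_prob :: "real \<Rightarrow> real \<Rightarrow> nat \<Rightarrow> real" where
  "down_prob N l n =
     1 / (2 * (1 + l)) * ((1 + (2 * real n + 1) * N) / (1 + (2 * real n - 1) * N))"

definition stay_prob :: "real \<Rightarrow> real \<Rightarrow> nat \<Rightarrow> real" where
  "stay_prob N l n =
     (if n = 0 then 1 - up_prob N l 0 else 1 - up_prob N l n - down_prob N l n)"

definition walk_op :: "real \<Rightarrow> real \<Rightarrow> nat \<Rightarrow> nat \<Rightarrow> real" where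
  "walk_op N l n m =
     (if m = n + 1 then up_prob N l n
      else if m = n then stay_prob N l n
      else if n = m + 1 then down_prob N l n
      else 0)"

text \<open>Products of infinite matrices and row vectors. They are written with \<open>suminf\<close>, which is
  unspecified for divergent series; every column of \<open>walk_op\<close> has finite support, so a series in
  which it is the right factor is a finite sum.\<close>

definition inf_mat_mult ::
    "(nat \<Rightarrow> nat \<Rightarrow> real) \<Rightarrow> (nat \<Rightarrow> nat \<Rightarrow> real) \<Rightarrow> nat \<Rightarrow> nat \<Rightarrow> real" where
  "inf_mat_mult A B i k = (\<Sum>m. A i m * B m k)"

primrec inf_mat_power :: "(nat \<Rightarrow> nat \<Rightarrow> real) \<Rightarrow> nat \<Rightarrow> nat \<Rightarrow> nat \<Rightarrow> real" where
  "inf_mat_power A 0 = (\<lambda>i k. if i = k then 1 else 0)"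
| "inf_mat_power A (Suc t) = inf_mat_mult (inf_mat_power A t) A"

definition row_mult :: "(nat \<Rightarrow> real) \<Rightarrow> (nat \<Rightarrow> nat \<Rightarrow> real) \<Rightarrow> nat \<Rightarrow> real" where
  "row_mult v A k = (\<Sum>n. v n * A n k)"

definition walk_dist :: "(nat \<Rightarrow> nat \<Rightarrow> real) \<Rightarrow> nat \<Rightarrow> nat \<Rightarrow> nat \<Rightarrow> real" where
  "walk_dist A j t n = inf_mat_power A t j n"

definition stationary :: "(nat \<Rightarrow> nat \<Rightarrow> real) \<Rightarrow> nat pmf \<Rightarrow> bool" where
  "stationary A \<nu> \<longleftrightarrow> row_mult (pmf \<nu>) A = pmf \<nu>"

definition tv_dist :: "(nat \<Rightarrow> real) \<Rightarrow> (nat \<Rightarrow> real) \<Rightarrow> real" where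
  "tv_dist \<nu> \<mu> = 1 / 2 * (\<Sum>x. \<bar>\<nu> x - \<mu> x\<bar>)"

text \<open>The lower bound on \<open>l\<close> is what makes \<open>walk_op\<close> a stochastic matrix: it says that
  \<open>stay_prob N l 1 \<ge> 0\<close>.\<close>

lemma stay_prob_nonneg:
  fixes N l :: real
  assumes N: "N > 0" and l: "l \<ge> 2 * N\<^sup>2 / ((1 + N) * (1 + 3 * N))"
  shows "stay_prob N l n \<ge> 0"
proof -
  have "2 * N\<^sup>2 / ((1 + N) * (1 + 3 * N)) > 0" using N by simp
  with l have l0: "l > 0" by linarith
  show ?thesis
  proof (cases "n = 0")
    case True
    have "1 * 1 \<le> (1 + l) * (N + 1)" using N l0 by (intro mult_mono) auto
    then show ?thesis using True by (simp add: stay_prob_def up_prob_def)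
  next
    case False
    define a where "a = 1 + (2 * real n - 1) * N"
    have "N \<le> (2 * real n - 1) * N" using False N by (simp add: mult_le_cancel_right1)
    then have a: "a \<ge> 1 + N" by (simp add: a_def)
    have b: "1 + (2 * real n + 1) * N = a + 2 * N" by (simp add: a_def algebra_simps)
    have mono: "(1 + N) * (1 + 3 * N) \<le> a * (a + 2 * N)"
      using a N by (intro mult_mono) auto
    have "2 * N\<^sup>2 \<le> l * ((1 + N) * (1 + 3 * N))"
      using l N by (simp add: pos_divide_le_eq)
    also have "\<dots> \<le> l * (a * (a + 2 * N))" using mono l0 by (intro mult_left_mono) auto
    finally have "a\<^sup>2 + (a + 2 * N)\<^sup>2 \<le> 2 * (1 + l) * (a * (a + 2 * N))"
      by (simp add: power2_eq_square algebra_simps)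
    moreover have "a / (a + 2 * N) + (a + 2 * N) / a = (a\<^sup>2 + (a + 2 * N)\<^sup>2) / (a * (a + 2 * N))"
      using a N by (simp add: add_frac_eq power2_eq_square mult.commute)
    moreover have "a * (a + 2 * N) > 0" using a N by simp
    ultimately have "a / (a + 2 * N) + (a + 2 * N) / a \<le> 2 * (1 + l)"
      by (simp only: pos_divide_le_eq)
    then have "1 / (2 * (1 + l)) * (a / (a + 2 * N) + (a + 2 * N) / a) \<le> 1"
      using l0 by (simp add: field_simps)
    then show ?thesis
      using False unfolding stay_prob_def up_prob_def down_prob_def b a_def[symmetric]
      by (simp only: distrib_left if_False)
  qed
qed

lemma walk_op_stochastic:
  fixes N l :: real
  assumes N: "N > 0" and l: "l \<ge> 2 * N\<^sup>2 / ((1 + N) * (1 + 3 * N))"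
  shows "walk_op N l n m \<ge> 0" and "walk_op N l n sums 1"
proof -
  have "2 * N\<^sup>2 / ((1 + N) * (1 + 3 * N)) > 0" using N by simp
  with l have l0: "l > 0" by linarith
  have pos: "1 + (2 * real k - 1) * N > 0" if "k \<noteq> 0" for k
  proof -
    have "(2 * real k - 1) * N \<ge> 0" using that N by (intro mult_nonneg_nonneg) auto
    then show ?thesis by linarith
  qed
  have pos': "1 + (2 * real k + 1) * N > 0" for k
    using N by (intro add_pos_nonneg mult_nonneg_nonneg) auto
  show "walk_op N l n m \<ge> 0"
    using stay_prob_nonneg[OF N l, of n] l0 N pos[of n] pos'[of n]
    by (auto simp: walk_op_def up_prob_def down_prob_def)
  have "walk_op N l n sums (\<Sum>m \<in> {n - 1, n, n + 1}. walk_op N l n m)"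
    by (rule sums_finite) (auto simp: walk_op_def)
  also have "(\<Sum>m \<in> {n - 1, n, n + 1}. walk_op N l n m) = 1"
    by (cases n) (auto simp: walk_op_def stay_prob_def)
  finally show "walk_op N l n sums 1" .
qed

end

theory Submission
  imports Defs
begin

text \<open>Put \<open>a n = 1 + (2n - 1)N\<close>. Detailed balance shows that the stationary tail is
  \<open>\<nu>[n,\<infinity>) = 1 / a n\<close> for \<open>n \<ge> 1\<close>. The rescaled excess tails
  \<open>S\<^sub>t n = a n * (\<mu>\<^sub>t[n,\<infinity>) - \<nu>[n,\<infinity>))\<close>, continued to \<open>n \<le> 0\<close> by \<open>S\<^sub>t (1 - n) = - S\<^sub>t n\<close>,
  solve the homogeneous lattice heat equation on the integers with jump rate
  \<open>k = 1 / (2(1 + l)) < 1/2\<close>. The equation for \<open>n \<ge> 2\<close> uses that \<open>a\<close> is affine, and the value of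
  \<open>p\<^sub>0\<close> is exactly the one that turns the boundary equation at \<open>n = 1\<close> into this antisymmetry.

  Upper bound: the initial increments have finite support, so the increments of \<open>S\<^sub>t\<close> are
  \<open>O(1/\<surd>t)\<close> by the heat kernel bound, and \<open>\<bar>S\<^sub>t n\<bar> = O(n/\<surd>t)\<close> by antisymmetry. Hence
  \<open>\<mu>\<^sub>t n - \<nu> n = O(1/(n\<surd>t))\<close>, and summing over the sites \<open>n \<le> t + j\<close> that the walk can reach
  gives \<open>ln t / \<surd>t\<close>; the unreachable sites have \<open>\<nu>\<close>-mass \<open>O(1/t)\<close>.

  Lower bound: \<open>S\<^sub>0 = -1\<close> to the right of \<open>j\<close>, and comparison with a quadratic solution of the heat
  equation gives \<open>S\<^sub>t n \<le> -1/2\<close> at a site \<open>n\<close> of order \<open>\<surd>t\<close>, where the excess tail is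
  therefore at least of order \<open>1/\<surd>t\<close>.\<close>

section \<open>The lattice heat equation\<close>

definition heat :: "real \<Rightarrow> (int \<Rightarrow> real) \<Rightarrow> int \<Rightarrow> real" where
  "heat k f n = (1 - 2 * k) * f n + k * (f (n - 1) + f (n + 1))"

text \<open>Fourier inversion for the lazy symmetric walk on the integers that jumps to each
  neighbour with probability \<open>k\<close>: the base of the power is its characteristic function,
  and evenness folds the integral onto \<open>{0..pi}\<close>.\<close>

definition heat_kernel :: "real \<Rightarrow> nat \<Rightarrow> int \<Rightarrow> real" where
  "heat_kernel k t n =
     integral {0..pi} (\<lambda>x. (1 - 2 * k + 2 * k * cos x) ^ t * cos (of_int n * x)) / pi"

lemma heat_kernel_0: "heat_kernel k 0 n = (if n = 0 then 1 else 0)"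
proof (cases "n = 0")
  case False
  have "((\<lambda>x. cos (of_int n * x)) has_integral
      sin (of_int n * pi) / of_int n - sin (of_int n * 0) / of_int n) {0..pi}"
    using False
    by (intro fundamental_theorem_of_calculus)
       (auto intro!: derivative_eq_intros simp flip: has_real_derivative_iff_has_vector_derivative)
  moreover have "sin (of_int n * pi) = 0"
    using sin_npi_int[of n] by (simp add: mult.commute)
  ultimately show ?thesis
    using False by (simp add: heat_kernel_def integral_unique)
qed (simp add: heat_kernel_def)

text \<open>Multiplying a cosine mode by the symbol acts as \<open>heat\<close> does on its
  frequency, because twice the product with \<open>cos x\<close> is the sum of the two neighbouring
  modes.\<close>

lemma heat_kernel_Suc: "heat_kernel k (Suc t) = heat k (heat_kernel k t)"
proof
  fix n
  define f where "f m = (\<lambda>x. (1 - 2 * k + 2 * k * cos x) ^ t * cos (of_int m * x))" for m :: int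
  have int: "f m integrable_on {0..pi}" for m
    unfolding f_def by (intro integrable_continuous_real continuous_intros)
  have kernel: "heat_kernel k t m = integral {0..pi} (f m) / pi" for m
    by (simp add: heat_kernel_def f_def)
  have "(1 - 2 * k + 2 * k * cos x) ^ Suc t * cos (of_int n * x) =
      (1 - 2 * k) * f n x + k * (f (n - 1) x + f (n + 1) x)" for x
    by (simp add: f_def algebra_simps cos_add cos_diff)
  then have "heat_kernel k (Suc t) n =
      integral {0..pi} (\<lambda>x. (1 - 2 * k) * f n x + k * (f (n - 1) x + f (n + 1) x)) / pi"
    by (simp only: heat_kernel_def)
  also have "\<dots> = ((1 - 2 * k) * integral {0..pi} (f n) +
      k * (integral {0..pi} (f (n - 1)) + integral {0..pi} (f (n + 1)))) / pi"
    using int by (simp add: integral_add integrable_add integrable_on_mult_right)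
  also have "\<dots> = heat k (heat_kernel k t) n"
    by (simp add: heat_def kernel add_divide_distrib distrib_left)
  finally show "heat_kernel k (Suc t) n = heat k (heat_kernel k t) n" .
qed

section \<open>Decay of the heat kernel\<close>

lemma sin_ge_chord:
  fixes x :: real
  assumes "0 \<le> x" "x \<le> pi / 2"
  shows "2 * x / pi \<le> sin x"
proof -
  have "convex_on {0..pi / 2} (\<lambda>x. - sin x)"
    by (rule f''_ge0_imp_convex[where f' = "\<lambda>x. - cos x" and f'' = sin])
       (auto intro!: derivative_eq_intros sin_ge_zero)
  from convex_onD[OF this, of "2 * x / pi" 0 "pi / 2"] show ?thesis
    using assms by (simp add: field_simps)
qed

lemma one_minus_cos_ge:
  fixes x :: real
  assumes "0 \<le> x" "x \<le> pi"
  shows "2 * x\<^sup>2 / pi\<^sup>2 \<le> 1 - cos x"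
proof -
  have "(2 * (x / 2) / pi)\<^sup>2 \<le> (sin (x / 2))\<^sup>2"
    using assms by (intro power_mono sin_ge_chord) auto
  then show ?thesis
    using cos_double_sin[of "x / 2"] by (simp add: power_divide)
qed

text \<open>The symbol stays away from 1 by the lower bound on \<open>1 - cos x\<close>, and away
  from -1 because \<open>k < 1 / 2\<close> excludes parity oscillation; the two arguments of
  \<open>min\<close> serve these two sides.\<close>

lemma heat_symbol_bound:
  fixes k x :: real
  assumes "0 < k" "k < 1 / 2" "0 \<le> x" "x \<le> pi"
  shows "\<bar>1 - 2 * k + 2 * k * cos x\<bar> \<le> 1 - min (4 * k) (2 - 4 * k) / pi\<^sup>2 * x\<^sup>2"
proof -
  define m where "m = min (4 * k) (2 - 4 * k)"
  have q: "x\<^sup>2 / pi\<^sup>2 \<le> 1" "0 \<le> x\<^sup>2 / pi\<^sup>2"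
    using assms by (auto simp: power_mono)
  have "m * (x\<^sup>2 / pi\<^sup>2) \<le> 4 * k * (x\<^sup>2 / pi\<^sup>2)"
    using q by (intro mult_right_mono) (auto simp: m_def)
  also have "\<dots> \<le> 2 * k * (1 - cos x)"
    using mult_left_mono[OF one_minus_cos_ge[OF assms(3,4)], of "2 * k"] assms(1) by simp
  finally have 1: "m * (x\<^sup>2 / pi\<^sup>2) \<le> 2 * k * (1 - cos x)" .
  have "m * (x\<^sup>2 / pi\<^sup>2) \<le> (2 - 4 * k) * 1"
    using q assms by (intro mult_mono) (auto simp: m_def)
  moreover have "k * (1 - cos x) \<le> k * 2"
    using assms(1) cos_ge_minus_one[of x] by (intro mult_left_mono) linarith+
  ultimately show ?thesis
    using 1 unfolding m_def[symmetric] by (simp add: abs_le_iff algebra_simps)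
qed

text \<open>Bernoulli's inequality combined with \<open>(1 - y) * (1 + y) \<le> 1\<close>. A
  rational majorant is convenient because its integral below is an arctangent.\<close>

lemma one_minus_power_le:
  fixes y :: real
  assumes "0 \<le> y" "y \<le> 1"
  shows "(1 - y) ^ t \<le> 1 / (1 + real t * y)"
proof -
  have "(1 - y) ^ t * (1 + real t * y) \<le> (1 - y) ^ t * (1 + y) ^ t"
    using assms Bernoulli_inequality[of y t] by (intro mult_left_mono) auto
  also have "\<dots> = (1 - y\<^sup>2) ^ t"
    by (simp add: power_mult_distrib[symmetric] algebra_simps power2_eq_square)
  also have "\<dots> \<le> 1"
    using assms by (intro power_le_one) (auto simp: power_le_one)
  finally show ?thesis
    using assms by (simp add: pos_le_divide_eq add_pos_nonneg)
qed

text \<open>Dropping the cosine makes the bound uniform in \<open>n\<close>. What remains is an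
  arctangent integral at scale \<open>s\<close>, at most \<open>pi / s\<close> with \<open>s\<close>
  of order \<open>sqrt (real t)\<close>.\<close>

lemma heat_kernel_bound:
  fixes k :: real
  assumes k: "0 < k" "k < 1 / 2"
  obtains C where "C > 0" "\<And>t n. t > 0 \<Longrightarrow> \<bar>heat_kernel k t n\<bar> \<le> C / sqrt (real t)"
proof -
  define c where "c = min (4 * k) (2 - 4 * k) / pi\<^sup>2"
  have c: "c > 0" using k by (simp add: c_def)
  have "\<bar>heat_kernel k t n\<bar> \<le> 1 / sqrt c / sqrt (real t)" if t: "t > 0" for t n
  proof -
    define s where "s = sqrt (c * real t)"
    have s: "s > 0" "s\<^sup>2 = c * real t" using c t by (auto simp: s_def)
    have deriv: "((\<lambda>x. arctan (s * x) / s) has_real_derivative 1 / (1 + real t * (c * x\<^sup>2)))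
        (at x within {0..pi})" for x
    proof -
      have "1 + (s * x)\<^sup>2 = 1 + real t * (c * x\<^sup>2)"
        by (simp add: power_mult_distrib s(2) algebra_simps)
      moreover have "((\<lambda>x. arctan (s * x) / s) has_real_derivative 1 / (1 + (s * x)\<^sup>2))
          (at x within {0..pi})"
        using s(1) by (auto intro!: derivative_eq_intros simp: divide_inverse)
      ultimately show ?thesis by simp
    qed
    have int: "((\<lambda>x. 1 / (1 + real t * (c * x\<^sup>2))) has_integral
        arctan (s * pi) / s - arctan (s * 0) / s) {0..pi}"
      using deriv by (intro fundamental_theorem_of_calculus)
        (auto simp flip: has_real_derivative_iff_has_vector_derivative)
    have pt: "norm ((1 - 2 * k + 2 * k * cos x) ^ t * cos (of_int n * x)) \<le>
        1 / (1 + real t * (c * x\<^sup>2))" if x: "x \<in> {0..pi}" for x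
    proof -
      have *: "\<bar>1 - 2 * k + 2 * k * cos x\<bar> \<le> 1 - c * x\<^sup>2"
        using heat_symbol_bound[OF k, of x] x by (simp add: c_def)
      have "norm ((1 - 2 * k + 2 * k * cos x) ^ t * cos (of_int n * x)) \<le>
          \<bar>1 - 2 * k + 2 * k * cos x\<bar> ^ t * 1"
        unfolding real_norm_def abs_mult power_abs by (intro mult_left_mono) auto
      also have "\<dots> \<le> (1 - c * x\<^sup>2) ^ t"
        using power_mono[OF *, of t] by simp
      \<comment> \<open>Since \<open>1 - c * x\<^sup>2\<close> dominates an absolute value,
        \<open>c * x\<^sup>2 \<le> 1\<close>.\<close>
      also have "\<dots> \<le> 1 / (1 + real t * (c * x\<^sup>2))"
        using * c by (intro one_minus_power_le) auto
      finally show ?thesis .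
    qed
    have "norm (integral {0..pi} (\<lambda>x. (1 - 2 * k + 2 * k * cos x) ^ t * cos (of_int n * x))) \<le>
        integral {0..pi} (\<lambda>x. 1 / (1 + real t * (c * x\<^sup>2)))"
    proof (rule integral_norm_bound_integral[OF _ has_integral_integrable[OF int] pt])
      show "(\<lambda>x. (1 - 2 * k + 2 * k * cos x) ^ t * cos (of_int n * x)) integrable_on {0..pi}"
        by (intro integrable_continuous_real continuous_intros)
    qed
    also have "\<dots> = arctan (s * pi) / s"
      using integral_unique[OF int] by simp
    also have "\<dots> \<le> pi / s"
      using s(1) arctan_ubound[of "s * pi"] pi_gt_zero by (intro divide_right_mono) linarith+
    finally show ?thesis
      by (simp add: heat_kernel_def s_def real_sqrt_mult field_simps)
  qed
  moreover have "1 / sqrt c > 0" using c by simp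
  ultimately show thesis using that by blast
qed

section \<open>Iterates of the heat operator\<close>

lemma funpow_heat_Suc:
  "(heat k ^^ Suc t) f n = (1 - 2 * k) * (heat k ^^ t) f n
     + k * ((heat k ^^ t) f (n - 1) + (heat k ^^ t) f (n + 1))"
  by (simp only: funpow.simps o_apply heat_def)

text \<open>Comparison principle: for \<open>k\<close> in this range a step is an average with
  nonnegative weights.\<close>

lemma funpow_heat_mono:
  assumes "0 \<le> k" "k \<le> 1 / 2" "\<And>n. f n \<le> g n"
  shows "(heat k ^^ t) f n \<le> (heat k ^^ t) g n"
  using assms(3)
proof (induction t arbitrary: n)
  case (Suc t)
  then show ?case
    using assms(1,2) unfolding funpow_heat_Suc by (auto intro!: add_mono mult_left_mono)
qed simp

lemma heat_diff: "heat k f n - heat k f (n - 1) = heat k (\<lambda>n. f n - f (n - 1)) n"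
  by (simp add: heat_def algebra_simps)

lemma funpow_heat_diff:
  "(heat k ^^ t) f n - (heat k ^^ t) f (n - 1) = (heat k ^^ t) (\<lambda>n. f n - f (n - 1)) n"
proof (induction t arbitrary: n)
  case (Suc t)
  then show ?case by (simp add: heat_diff)
qed simp

text \<open>\<open>heat\<close> commutes with the reflection about 1/2, so the boundary condition at
  the origin persists in time.\<close>

lemma funpow_heat_antisym:
  assumes "\<And>n. f (1 - n) = - f n"
  shows "(heat k ^^ t) f (1 - n) = - (heat k ^^ t) f n"
proof (induction t arbitrary: n)
  case (Suc t)
  show ?case
    using Suc.IH[of n] Suc.IH[of "n + 1"] Suc.IH[of "n - 1"]
    unfolding funpow_heat_Suc by (simp add: algebra_simps)
qed (simp add: assms)

text \<open>Finite propagation speed: \<open>t\<close> steps see only the sites within distance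
  \<open>t\<close>.\<close>

lemma funpow_heat_const:
  assumes "\<And>m. \<bar>m - n\<bar> \<le> int t \<Longrightarrow> f m = c"
  shows "(heat k ^^ t) f n = c"
  using assms
proof (induction t arbitrary: n)
  case (Suc t)
  have "(heat k ^^ t) f m = c" if "\<bar>m - n\<bar> \<le> 1" for m
    using that by (intro Suc.IH Suc.prems) auto
  then show ?case unfolding funpow_heat_Suc by (simp add: algebra_simps)
qed simp

text \<open>Each step adds \<open>2 * k\<close>, the variance of one jump, to the square.\<close>

lemma funpow_heat_quadratic:
  "(heat k ^^ t) (\<lambda>n. A + B * (of_int (n - m))\<^sup>2) n = A + B * ((of_int (n - m))\<^sup>2 + 2 * k * real t)"
proof (induction t arbitrary: n)
  case (Suc t)
  show ?case unfolding funpow_heat_Suc Suc.IH by (simp add: algebra_simps power2_eq_square)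
qed simp

text \<open>Superposition: the kernel starts as a unit mass at 0, and \<open>heat\<close> is linear
  and translation invariant.\<close>

lemma funpow_heat_kernel_sum:
  assumes "finite A" "\<And>n. n \<notin> A \<Longrightarrow> f n = 0"
  shows "(heat k ^^ t) f n = (\<Sum>m\<in>A. f m * heat_kernel k t (n - m))"
proof (induction t arbitrary: n)
  case 0
  have "(\<Sum>m\<in>A. f m * heat_kernel k 0 (n - m)) = (\<Sum>m\<in>A. if n = m then f m else 0)"
    by (intro sum.cong) (auto simp: heat_kernel_0)
  then show ?case using assms by (simp add: sum.delta')
next
  case (Suc t)
  have shift: "n - 1 - m = n - m - 1" "n + 1 - m = n - m + 1" for m :: int
    by auto
  have "(heat k ^^ Suc t) f n = heat k (\<lambda>n. \<Sum>m\<in>A. f m * heat_kernel k t (n - m)) n"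
    by (simp add: Suc.IH[abs_def])
  also have "\<dots> = (\<Sum>m\<in>A. f m * heat k (heat_kernel k t) (n - m))"
    by (simp add: heat_def sum_distrib_left sum.distrib[symmetric] shift algebra_simps)
  finally show ?case by (simp add: heat_kernel_Suc)
qed

lemma funpow_heat_sup_bound:
  assumes "0 < k" "k < 1 / 2" "finite A" "\<And>n. n \<notin> A \<Longrightarrow> f n = 0"
  shows "\<exists>C>0. \<forall>t>0. \<forall>n. \<bar>(heat k ^^ t) f n\<bar> \<le> C / sqrt (real t)"
proof -
  obtain C where C: "C > 0" "\<And>t n. t > 0 \<Longrightarrow> \<bar>heat_kernel k t n\<bar> \<le> C / sqrt (real t)"
    using heat_kernel_bound[OF assms(1,2)] by metis
  \<comment> \<open>The \<open>+ 1\<close> keeps the constant positive even if \<open>f\<close>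
    vanishes identically.\<close>
  have "\<bar>(heat k ^^ t) f n\<bar> \<le> ((\<Sum>m\<in>A. \<bar>f m\<bar>) + 1) * C / sqrt (real t)" if "t > 0" for t n
  proof -
    have "\<bar>(heat k ^^ t) f n\<bar> \<le> (\<Sum>m\<in>A. \<bar>f m * heat_kernel k t (n - m)\<bar>)"
      using assms(3,4) by (subst funpow_heat_kernel_sum[of A]) (auto intro: sum_abs)
    also have "\<dots> \<le> (\<Sum>m\<in>A. \<bar>f m\<bar> * (C / sqrt (real t)))"
      unfolding abs_mult using C(2) that by (intro sum_mono mult_left_mono) auto
    also have "\<dots> \<le> ((\<Sum>m\<in>A. \<bar>f m\<bar>) + 1) * (C / sqrt (real t))"
      unfolding sum_distrib_right[symmetric] using C(1) by (intro mult_right_mono) auto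
    finally show ?thesis by simp
  qed
  moreover have "((\<Sum>m\<in>A. \<bar>f m\<bar>) + 1) * C > 0"
    using C(1) by (intro mult_pos_pos add_nonneg_pos sum_nonneg) auto
  ultimately show ?thesis by blast
qed

section \<open>The rescaled excess tails of the walk\<close>

lemma row_mult_walk_op_0:
  "row_mult v (walk_op N l) 0 = v 0 * stay_prob N l 0 + v 1 * down_prob N l 1"
proof -
  have "row_mult v (walk_op N l) 0 = (\<Sum>n\<in>{0,1}. v n * walk_op N l n 0)"
    unfolding row_mult_def by (rule suminf_finite) (auto simp: walk_op_def)
  then show ?thesis by (simp add: walk_op_def)
qed

lemma row_mult_walk_op_Suc:
  "row_mult v (walk_op N l) (Suc m) =
     v m * up_prob N l m + v (Suc m) * stay_prob N l (Suc m)
     + v (Suc (Suc m)) * down_prob N l (Suc (Suc m))"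
proof -
  have "row_mult v (walk_op N l) (Suc m) =
      (\<Sum>n\<in>{m, Suc m, Suc (Suc m)}. v n * walk_op N l n (Suc m))"
    unfolding row_mult_def by (rule suminf_finite) (auto simp: walk_op_def)
  then show ?thesis by (simp add: walk_op_def)
qed

definition flux :: "real \<Rightarrow> real \<Rightarrow> (nat \<Rightarrow> real) \<Rightarrow> nat \<Rightarrow> real" where
  "flux N l v n = v n * up_prob N l n - v (Suc n) * down_prob N l (Suc n)"

text \<open>Conservation of mass: \<open>flux\<close> is the net mass crossing from \<open>n\<close>
  to \<open>Suc n\<close> in one step, and nothing enters site 0 from the left.\<close>

lemma row_mult_eq_flux:
  "row_mult v (walk_op N l) n = v n + (if n = 0 then 0 else flux N l v (n - 1)) - flux N l v n"
  by (cases n)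
     (simp_all add: row_mult_walk_op_0 row_mult_walk_op_Suc flux_def stay_prob_def algebra_simps)

text \<open>With no flux through the left end, conservation forces the flux through each successive
  edge to vanish, which is detailed balance.\<close>

lemma stationary_flux:
  assumes "row_mult v (walk_op N l) = v"
  shows "flux N l v n = 0"
proof (induction n)
  case 0
  show ?case using fun_cong[OF assms, of 0] by (simp add: row_mult_eq_flux)
next
  case (Suc n)
  show ?case using fun_cong[OF assms, of "Suc n"] Suc by (simp add: row_mult_eq_flux)
qed

lemma walk_dist_Suc: "walk_dist A j (Suc t) = row_mult (walk_dist A j t) A"
  by (simp add: fun_eq_iff walk_dist_def inf_mat_mult_def row_mult_def)

definition step_rate :: "real \<Rightarrow> real" where
  "step_rate l = 1 / (2 * (1 + l))"

definition site_weight :: "real \<Rightarrow> nat \<Rightarrow> real" where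
  "site_weight N n = 1 + (2 * real n - 1) * N"

text \<open>Site 0 is separate because the tail there is the total mass 1, whereas
  \<open>site_weight N 0\<close> is \<open>1 - N\<close>.\<close>

definition stat_tail :: "real \<Rightarrow> nat \<Rightarrow> real" where
  "stat_tail N n = (if n = 0 then 1 else 1 / site_weight N n)"

definition stat_mass :: "real \<Rightarrow> nat \<Rightarrow> real" where
  "stat_mass N n = stat_tail N n - stat_tail N (Suc n)"

text \<open>At site 0 both tails are the total mass, so the excess there is 0.\<close>

definition excess_tail :: "real \<Rightarrow> (int \<Rightarrow> real) \<Rightarrow> nat \<Rightarrow> real" where
  "excess_tail N s n = (if n = 0 then 0 else s (int n) / site_weight N n)"

text \<open>For positive \<open>n\<close> this is \<open>site_weight N n\<close> times the excess of the tail of the unit mass at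
  \<open>j\<close> over the stationary tail; it is continued antisymmetrically about \<open>1/2\<close>.\<close>

definition initial_profile :: "real \<Rightarrow> nat \<Rightarrow> int \<Rightarrow> real" where
  "initial_profile N j n =
    (if n > 0 then (if n \<le> int j then site_weight N (nat n) else 0) - 1
     else 1 - (if 1 - n \<le> int j then site_weight N (nat (1 - n)) else 0))"

context
  fixes N l :: real
  assumes N: "N > 0" and l: "l > 0"
begin

abbreviation "k \<equiv> step_rate l"

abbreviation "profile j t \<equiv> (heat k ^^ t) (initial_profile N j)"

lemma rate: "0 < k" "k < 1 / 2"
  using l by (auto simp: step_rate_def field_simps)

lemma site_weight_ge: "n > 0 \<Longrightarrow> N * real n \<le> site_weight N n"
  "n > 0 \<Longrightarrow> 1 + N \<le> site_weight N n"
  "n > 0 \<Longrightarrow> 0 < site_weight N n"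
proof -
  assume n: "n > 0"
  have "real n * N \<le> (2 * real n - 1) * N" "1 * N \<le> (2 * real n - 1) * N"
    using n N by (intro mult_right_mono; simp)+
  then show "N * real n \<le> site_weight N n" "1 + N \<le> site_weight N n"
    by (auto simp: site_weight_def mult.commute)
  then show "0 < site_weight N n" using N by linarith
qed

lemma site_weight_Suc: "site_weight N (Suc n) = site_weight N n + 2 * N"
  by (simp add: site_weight_def algebra_simps)

lemma up_prob_eq: "up_prob N l n = (if n = 0 then 2 * k / site_weight N 1 else
    k * (site_weight N n / site_weight N (Suc n)))"
proof (cases "n = 0")
  case True
  have "1 / ((1 + l) * (N + 1)) = 2 * (1 / (2 * (1 + l))) / (1 + N)"
    using N l by (simp add: divide_simps) (simp add: algebra_simps)
  then show ?thesis using True by (simp add: up_prob_def site_weight_def step_rate_def)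
next
  case False
  have "1 + (2 * real (Suc n) - 1) * N = 1 + (2 * real n + 1) * N"
    by simp
  then show ?thesis using False by (simp only: up_prob_def site_weight_def step_rate_def if_False)
qed

lemma down_prob_eq: "down_prob N l n = k * (site_weight N (Suc n) / site_weight N n)"
proof -
  have "1 + (2 * real (Suc n) - 1) * N = 1 + (2 * real n + 1) * N"
    by simp
  then show ?thesis by (simp only: down_prob_def site_weight_def step_rate_def)
qed

text \<open>For \<open>n > 0\<close> and \<open>a = site_weight N n\<close>, the two opposite
  currents across the edge both equal \<open>k * 2 * N / (a + 2 * N)\<^sup>2\<close>.\<close>

lemma flux_stat_mass: "flux N l (stat_mass N) n = 0"
proof (cases "n = 0")
  case True
  \<comment> \<open>Here \<open>p\<close> stands for the weight \<open>1 + N\<close> of site 1, so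
    that \<open>3 * p - 2\<close> is the weight of site 2.\<close>
  have "2 - 2 / p = (1 / p - 1 / (3 * p - 2)) * (3 * p - 2)" if "p > 1" for p :: real
    using that by (simp add: left_diff_distrib diff_divide_distrib)
  from this[of "1 + N"] have "2 - 2 / (1 + N) = (1 / (1 + N) - 1 / (1 + 3 * N)) * (1 + 3 * N)"
    using N by (simp add: algebra_simps)
  then show ?thesis
    using True N
    by (simp add: flux_def stat_mass_def stat_tail_def up_prob_eq down_prob_eq site_weight_def)
next
  case False
  define a where "a = site_weight N n"
  have a: "a > 0" using site_weight_ge(3)[of n] False by (simp add: a_def)
  have "(1 / a - 1 / (a + 2 * N)) * (a / (a + 2 * N)) =
      (1 / (a + 2 * N) - 1 / (a + 2 * N + 2 * N)) * ((a + 2 * N + 2 * N) / (a + 2 * N))"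
    using a N by (simp add: divide_simps)
  moreover have "u * (k * u') - v * (k * v') = k * (u * u' - v * v')" for u u' v v'
    by (simp add: algebra_simps)
  ultimately have "(1 / a - 1 / (a + 2 * N)) * (k * (a / (a + 2 * N))) -
      (1 / (a + 2 * N) - 1 / (a + 2 * N + 2 * N)) * (k * ((a + 2 * N + 2 * N) / (a + 2 * N))) = 0"
    by (simp only: diff_self mult_zero_right)
  moreover have "site_weight N (Suc n) = a + 2 * N" "site_weight N (Suc (Suc n)) = a + 2 * N + 2 * N"
    by (simp_all add: site_weight_Suc a_def)
  ultimately show ?thesis
    using False by (simp only: flux_def stat_mass_def stat_tail_def up_prob_eq down_prob_eq
        a_def[symmetric] if_False nat.distinct)
qed

text \<open>The tail from \<open>Suc n\<close> on grows by the flux into it, so this is the heat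
  equation for the rescaled tail \<open>s\<close>. For \<open>n > 0\<close> the affine weights give
  the central value the coefficient \<open>- 2\<close>.\<close>

lemma flux_excess:
  assumes "s 0 = - s 1"
  shows "flux N l (\<lambda>n. excess_tail N s n - excess_tail N s (Suc n)) n =
    excess_tail N (heat k s) (Suc n) - excess_tail N s (Suc n)"
proof (cases "n = 0")
  case True
  define a where "a = site_weight N 1"
  have a: "a > 0" "a = 1 + N" by (use N in \<open>auto simp: a_def site_weight_def\<close>)
  have w: "site_weight N (Suc 0) = a" "site_weight N (Suc (Suc 0)) = a + 2 * N"
    by (auto simp: a_def site_weight_Suc)
  have "(0 - s 1 / a) * (2 * k / a) - (s 1 / a - s 2 / (a + 2 * N)) * (k * ((a + 2 * N) / a)) =
     ((1 - 2 * k) * s 1 + k * (- s 1 + s 2)) / a - s 1 / a"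
  proof -
    \<comment> \<open>Since \<open>a = 1 + N\<close>, \<open>2 + (a + 2 * N) = 3 * a\<close>. The
      coefficient \<open>- 3\<close> is the usual \<open>- 2\<close> together with the reflected
      value \<open>s 0 = - s 1\<close>.\<close>
    have "- (s 1 / a) * 2 - (s 1 / a - s 2 / (a + 2 * N)) * (a + 2 * N) = - 3 * s 1 + s 2"
      using N unfolding a(2) by (simp add: divide_simps) (simp add: algebra_simps)
    moreover have "(0 - u) * (2 * k / a) - v * (k * (b / a)) = k / a * (- u * 2 - v * b)" for u v b
      by (simp add: algebra_simps)
    moreover have "k / a * (- 3 * s 1 + s 2) = ((1 - 2 * k) * s 1 + k * (- s 1 + s 2)) / a - s 1 / a"
      by (simp add: diff_divide_distrib[symmetric] algebra_simps)
    ultimately show ?thesis by (simp only:)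
  qed
  then show ?thesis
    using True assms by (simp add: flux_def excess_tail_def up_prob_eq down_prob_eq heat_def w)
next
  case False
  define a where "a = site_weight N n"
  have a: "a > 0" using site_weight_ge(3)[of n] False by (simp add: a_def)
  define x y z where "x = s (int n)" and "y = s (1 + int n)" and "z = s (2 + int n)"
  have "(x / a - y / (a + 2 * N)) * (a / (a + 2 * N)) -
      (y / (a + 2 * N) - z / (a + 2 * N + 2 * N)) * ((a + 2 * N + 2 * N) / (a + 2 * N)) =
      (x + z - 2 * y) / (a + 2 * N)"
    using a N by (simp add: divide_simps) (simp add: algebra_simps)
  then have "k * ((x / a - y / (a + 2 * N)) * (a / (a + 2 * N)) -
      (y / (a + 2 * N) - z / (a + 2 * N + 2 * N)) * ((a + 2 * N + 2 * N) / (a + 2 * N))) =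
      k * ((x + z - 2 * y) / (a + 2 * N))"
    by simp
  also have "\<dots> = ((1 - 2 * k) * y + k * (x + z)) / (a + 2 * N) - y / (a + 2 * N)"
    by (simp add: diff_divide_distrib[symmetric] algebra_simps)
  finally have "k * ((x / a - y / (a + 2 * N)) * (a / (a + 2 * N)) -
      (y / (a + 2 * N) - z / (a + 2 * N + 2 * N)) * ((a + 2 * N + 2 * N) / (a + 2 * N))) =
      ((1 - 2 * k) * y + k * (x + z)) / (a + 2 * N) - y / (a + 2 * N)" .
  moreover have "u * (k * u') - v * (k * v') = k * (u * u' - v * v')" for u u' v v'
    by (simp add: algebra_simps)
  ultimately have *: "(x / a - y / (a + 2 * N)) * (k * (a / (a + 2 * N))) -
      (y / (a + 2 * N) - z / (a + 2 * N + 2 * N)) * (k * ((a + 2 * N + 2 * N) / (a + 2 * N))) =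
      ((1 - 2 * k) * y + k * (x + z)) / (a + 2 * N) - y / (a + 2 * N)"
    by (simp only:)
  have "site_weight N (Suc n) = a + 2 * N" "site_weight N (Suc (Suc n)) = a + 2 * N + 2 * N"
    by (simp_all add: site_weight_Suc a_def)
  moreover have "int (Suc n) = 1 + int n" "int (Suc (Suc n)) = 2 + int n"
      "1 + int n - 1 = int n" "1 + int n + 1 = 2 + int n"
    by simp_all
  ultimately show ?thesis
    using False *
    by (simp only: flux_def excess_tail_def up_prob_eq down_prob_eq heat_def
        x_def y_def z_def a_def[symmetric] if_False nat.distinct)
qed

text \<open>\<open>flux\<close> is linear and the stationary part carries none, so only the excess
  evolves.\<close>

lemma row_mult_excess:
  assumes "s 0 = - s 1"
  shows "row_mult (\<lambda>n. stat_mass N n + (excess_tail N s n - excess_tail N s (Suc n))) (walk_op N l) =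
    (\<lambda>n. stat_mass N n + (excess_tail N (heat k s) n - excess_tail N (heat k s) (Suc n)))"
proof
  fix n
  have lin: "flux N l (\<lambda>n. stat_mass N n + (excess_tail N s n - excess_tail N s (Suc n))) m =
      flux N l (stat_mass N) m + flux N l (\<lambda>n. excess_tail N s n - excess_tail N s (Suc n)) m" for m
    by (simp add: flux_def algebra_simps)
  show "row_mult (\<lambda>n. stat_mass N n + (excess_tail N s n - excess_tail N s (Suc n))) (walk_op N l) n =
    stat_mass N n + (excess_tail N (heat k s) n - excess_tail N (heat k s) (Suc n))"
  proof (cases n)
    case 0
    then show ?thesis
      unfolding row_mult_eq_flux lin flux_stat_mass flux_excess[of s, OF assms]
      by (simp add: excess_tail_def)
  next
    case (Suc m)
    then show ?thesis
      unfolding row_mult_eq_flux lin flux_stat_mass flux_excess[of s, OF assms] by simp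
  qed
qed

lemma initial_profile_antisym: "initial_profile N j (1 - n) = - initial_profile N j n"
  by (auto simp: initial_profile_def)

lemma profile_antisym:
  "profile j t 0 = - profile j t 1"
  using funpow_heat_antisym[where f = "initial_profile N j" and n = 1] initial_profile_antisym by simp

text \<open>Antisymmetry holds at every time, so \<open>row_mult_excess\<close> gives both sides the
  same one-step recursion.\<close>

lemma walk_dist_eq_excess:
  "walk_dist (walk_op N l) j t n = stat_mass N n +
     (excess_tail N (profile j t) n
      - excess_tail N (profile j t) (Suc n))"
proof (induction t arbitrary: n)
  case 0
  have "excess_tail N (initial_profile N j) m = (if m \<le> j then 1 else 0) - stat_tail N m" for m
    using site_weight_ge(3)[of m]
    by (cases "m = 0") (auto simp: excess_tail_def initial_profile_def stat_tail_def diff_divide_distrib)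
  then show ?case by (auto simp: walk_dist_def stat_mass_def)
next
  case (Suc t)
  define s where "s = profile j t"
  have "s 0 = - s 1"
    unfolding s_def by (rule profile_antisym)
  moreover have "walk_dist (walk_op N l) j t =
      (\<lambda>n. stat_mass N n + (excess_tail N s n - excess_tail N s (Suc n)))"
    by (simp add: fun_eq_iff Suc.IH s_def)
  ultimately show ?case
    by (simp add: walk_dist_Suc row_mult_excess s_def)
qed

section \<open>The stationary distribution\<close>

lemma stat_tail_tendsto: "stat_tail N \<longlonglongrightarrow> 0"
proof (rule LIMSEQ_offset[where k = 1])
  have "(\<lambda>n. 1 / (1 + N + 2 * N * real n)) \<longlonglongrightarrow> 0"
    using N by real_asymp
  then show "(\<lambda>n. stat_tail N (n + 1)) \<longlonglongrightarrow> 0"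
    by (simp add: stat_tail_def site_weight_def algebra_simps)
qed

lemma stat_mass_sums: "(\<lambda>n. stat_mass N (n + m)) sums stat_tail N m"
  using telescope_sums'[OF LIMSEQ_ignore_initial_segment[OF stat_tail_tendsto, of m]]
  by (simp add: stat_mass_def)

lemma stat_mass_pos: "stat_mass N n > 0"
proof (cases "n = 0")
  case False
  then show ?thesis
    using site_weight_ge(3)[of n] N by (simp add: stat_mass_def stat_tail_def site_weight_Suc frac_less2)
qed (use N in \<open>simp add: stat_mass_def stat_tail_def site_weight_def\<close>)

text \<open>Vanishing flux is a first-order recursion with nonzero leading coefficient, so a
  stationary law is a multiple of \<open>stat_mass N\<close>; total mass 1 fixes the factor.\<close>

lemma stationary_iff: "stationary (walk_op N l) \<nu> \<longleftrightarrow> pmf \<nu> = stat_mass N"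
proof
  assume "pmf \<nu> = stat_mass N"
  then show "stationary (walk_op N l) \<nu>"
    unfolding stationary_def by (auto simp: row_mult_eq_flux flux_stat_mass)
next
  assume "stationary (walk_op N l) \<nu>"
  then have flux: "flux N l (pmf \<nu>) n = 0" for n
    by (intro stationary_flux) (simp add: stationary_def)
  define r where "r = pmf \<nu> 0 / stat_mass N 0"
  have scaled: "pmf \<nu> n = r * stat_mass N n" for n
  proof (induction n)
    case 0
    then show ?case using stat_mass_pos[of 0] by (simp add: r_def)
  next
    case (Suc n)
    have down: "down_prob N l (Suc n) \<noteq> 0"
      using site_weight_ge(3)[of "Suc n"] site_weight_ge(3)[of "Suc (Suc n)"] rate
      by (simp add: down_prob_eq)
    have "pmf \<nu> (Suc n) * down_prob N l (Suc n) = r * (stat_mass N n * up_prob N l n)"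
      using flux[of n] Suc by (simp add: flux_def)
    also have "\<dots> = r * stat_mass N (Suc n) * down_prob N l (Suc n)"
      using flux_stat_mass[of n] by (simp add: flux_def)
    finally show ?case using down by simp
  qed
  have "(\<lambda>n. r * stat_mass N n) sums (r * 1)"
    using stat_mass_sums[of 0] by (intro sums_mult) (simp add: stat_tail_def)
  moreover have "pmf \<nu> sums 1"
    using sums_infsetsum_nat[of "pmf \<nu>" UNIV] infsetsum_pmf_eq_1[of \<nu> UNIV] pmf_abs_summable[of \<nu> UNIV]
    by simp
  ultimately have "r = 1"
    using sums_unique2 unfolding scaled[abs_def] by fastforce
  then show "pmf \<nu> = stat_mass N" using scaled by (simp add: fun_eq_iff)
qed

lemma stationary_unique_exists: "\<exists>!\<nu>. stationary (walk_op N l) \<nu>"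
proof -
  have "(\<integral>\<^sup>+ n. ennreal (stat_mass N n) \<partial>count_space UNIV) = 1"
    using stat_mass_sums[of 0] stat_mass_pos
    by (simp add: nn_integral_count_space_nat suminf_ennreal2 sums_iff less_imp_le stat_tail_def)
  then have "pmf (embed_pmf (stat_mass N)) = stat_mass N"
    using stat_mass_pos by (simp add: fun_eq_iff pmf_embed_pmf less_imp_le)
  then show ?thesis
    unfolding stationary_iff by (metis pmf_eqI)
qed

section \<open>Total variation bounds\<close>

text \<open>Sites beyond \<open>t + j\<close> are out of reach at time \<open>t\<close>, so there
  the difference is the stationary mass and sums to a stationary tail.\<close>

lemma tv_sums:
  "(\<lambda>n. \<bar>stat_mass N n - walk_dist (walk_op N l) j t n\<bar>) sums (stat_tail N (t + j + 1) +
     (\<Sum>n<t + j + 1. \<bar>stat_mass N n - walk_dist (walk_op N l) j t n\<bar>))"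
proof -
  define d where "d n = \<bar>stat_mass N n - walk_dist (walk_op N l) j t n\<bar>" for n
  \<comment> \<open>Within distance \<open>t\<close> of such a site the initial profile is
    constantly -1, its value to the right of \<open>j\<close>.\<close>
  have "profile j t (int n) = - 1" if "n > t + j" for n
    using that by (intro funpow_heat_const) (auto simp: initial_profile_def)
  then have shift: "d (n + (t + j + 1)) = stat_mass N (n + (t + j + 1))" for n
    using stat_mass_pos[of "n + (t + j + 1)"]
    by (simp add: d_def walk_dist_eq_excess excess_tail_def stat_mass_def stat_tail_def
        del: of_nat_Suc of_nat_add)
  have "(\<lambda>n. d (n + (t + j + 1))) sums stat_tail N (t + j + 1)"
    unfolding shift by (rule stat_mass_sums)
  then have "d sums (stat_tail N (t + j + 1) + sum d {..<t + j + 1})"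
    by (rule sums_iff_shift[THEN iffD1])
  then show ?thesis by (simp only: d_def[abs_def])
qed

lemma tv_dist_eq:
  "tv_dist (stat_mass N) (walk_dist (walk_op N l) j t) = 1 / 2 * (stat_tail N (t + j + 1) +
     (\<Sum>n<t + j + 1. \<bar>stat_mass N n - walk_dist (walk_op N l) j t n\<bar>))"
  using tv_sums[of j t] by (simp add: tv_dist_def sums_iff)

text \<open>Up to sign, the excess tail is the excess mass of the sites below \<open>n\<close>,
  which the full sum of absolute differences dominates.\<close>

lemma excess_tail_le_tv:
  "\<bar>excess_tail N (profile j t) n\<bar> / 2
     \<le> tv_dist (stat_mass N) (walk_dist (walk_op N l) j t)"
proof -
  define T where "T = excess_tail N (profile j t)"
  have "(\<Sum>m<n. walk_dist (walk_op N l) j t m - stat_mass N m) = (\<Sum>m<n. T m - T (Suc m))"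
    by (simp add: walk_dist_eq_excess T_def)
  also have "\<dots> = T 0 - T n" by (rule sum_lessThan_telescope')
  finally have "\<bar>T n\<bar> = \<bar>\<Sum>m<n. walk_dist (walk_op N l) j t m - stat_mass N m\<bar>"
    by (simp add: T_def excess_tail_def)
  also have "\<dots> \<le> (\<Sum>m<n. \<bar>stat_mass N m - walk_dist (walk_op N l) j t m\<bar>)"
    by (subst abs_minus_commute) (rule sum_abs)
  also have "\<dots> \<le> (\<Sum>m. \<bar>stat_mass N m - walk_dist (walk_op N l) j t m\<bar>)"
    using tv_sums[of j t] by (intro sum_le_suminf) (auto simp: sums_iff)
  finally show ?thesis by (simp add: tv_dist_def T_def)
qed

section \<open>The lower bound\<close>

lemma initial_profile_le: "initial_profile N j n \<le> 1 + 2 * real j * N"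
proof -
  have *: "site_weight N m \<le> 1 + 2 * real j * N" if "m \<le> j" for m
  proof -
    have "(2 * real m - 1) * N \<le> 2 * real j * N" using that N by (intro mult_right_mono) auto
    then show ?thesis by (simp add: site_weight_def)
  qed
  have nonneg: "0 \<le> 2 * real j * N" using N by simp
  show ?thesis
  proof (cases "n > 0")
    case True
    then show ?thesis using *[of "nat n"] nonneg by (auto simp: initial_profile_def nat_le_iff)
  next
    case False
    then have "initial_profile N j n \<le> 1"
      using site_weight_ge(3)[of "nat (1 - n)"] by (auto simp: initial_profile_def)
    then show ?thesis using nonneg by linarith
  qed
qed

text \<open>Comparison with a parabola centred at \<open>j + L\<close>: it lies above the initial
  profile, and by time \<open>t\<close> its value at the centre has risen from -1 to at most
  -1/2.\<close>

lemma profile_lower: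
  fixes L :: nat
  assumes "L > 0" "4 * (2 + 2 * real j * N) * k * real t \<le> (real L)\<^sup>2"
  shows "profile j t (int (j + L)) \<le> - 1 / 2"
proof -
  \<comment> \<open>Chosen so that at distance \<open>L\<close> from its centre the parabola attains
    the bound of \<open>initial_profile_le\<close>; every site up to \<open>j\<close> is at least
    that far away.\<close>
  define B where "B = (2 + 2 * real j * N) / (real L)\<^sup>2"
  have B: "B \<ge> 0" using N by (simp add: B_def)
  have "initial_profile N j n \<le> - 1 + B * (of_int (n - int (j + L)))\<^sup>2" for n
  proof (cases "n > int j")
    case True
    then show ?thesis using B by (simp add: initial_profile_def)
  next
    case False
    then have "(real L)\<^sup>2 \<le> (of_int (n - int (j + L)))\<^sup>2"
      by (intro abs_le_square_iff[THEN iffD1]) auto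
    then have "B * (real L)\<^sup>2 \<le> B * (of_int (n - int (j + L)))\<^sup>2"
      using B by (rule mult_left_mono)
    moreover have "B * (real L)\<^sup>2 = 2 + 2 * real j * N" using assms(1) by (simp add: B_def)
    ultimately show ?thesis using initial_profile_le[of j n] by linarith
  qed
  then have "profile j t (int (j + L)) \<le>
      (heat k ^^ t) (\<lambda>n. - 1 + B * (of_int (n - int (j + L)))\<^sup>2) (int (j + L))"
    using rate by (intro funpow_heat_mono) auto
  also have "\<dots> = - 1 + B * (2 * k * real t)"
    by (simp only: funpow_heat_quadratic) simp
  also have "\<dots> \<le> - 1 / 2"
  proof -
    have "(2 + 2 * real j * N) * (2 * k * real t) \<le> 1 / 2 * (real L)\<^sup>2"
      using assms(2) by (simp add: algebra_simps)
    then have "B * (2 * k * real t) \<le> 1 / 2"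
      using assms(1) by (simp add: B_def pos_divide_le_eq)
    then show ?thesis by simp
  qed
  finally show ?thesis .
qed

lemma tv_lower:
  obtains c where "c > 0"
    "\<And>t. t > 0 \<Longrightarrow> c / sqrt (real t) \<le> tv_dist (stat_mass N) (walk_dist (walk_op N l) j t)"
proof -
  \<comment> \<open>\<open>A\<close> is the factor of \<open>real t\<close> in the hypothesis of
    \<open>profile_lower\<close>. As \<open>M \<ge> 1\<close> and \<open>M \<ge> A\<close>, also
    \<open>M\<^sup>2 \<ge> A\<close>, so \<open>L = M * r\<close> with \<open>r \<ge> sqrt t\<close>
    is admissible.\<close>
  define A where "A = 4 * (2 + 2 * real j * N) * k"
  define M where "M = nat \<lceil>A\<rceil> + 1"
  have "A \<le> real M" "real M \<ge> 1" unfolding M_def by linarith+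
  moreover from this have "real M * 1 \<le> real M * real M"
    by (intro mult_left_mono) auto
  ultimately have M: "A \<le> (real M)\<^sup>2" "real M \<ge> 1"
    unfolding power2_eq_square by linarith+
  \<comment> \<open>For \<open>r \<ge> 1\<close> this makes \<open>D * r\<close> an upper bound for
    the weight at site \<open>j + M * r\<close>.\<close>
  define D where "D = 1 + 2 * N * (real j + real M)"
  have D: "D > 0" using N unfolding D_def by (intro add_pos_nonneg) auto
  \<comment> \<open>The 8 collects a factor 2 from the profile value 1/2, one from
    \<open>r \<le> 2 * sqrt t\<close> and one from \<open>excess_tail_le_tv\<close>.\<close>
  have "1 / (8 * D) / sqrt (real t) \<le> tv_dist (stat_mass N) (walk_dist (walk_op N l) j t)"
    if t: "t > 0" for t
  proof -
    define r where "r = nat \<lceil>sqrt (real t)\<rceil>"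
    have st: "sqrt (real t) \<ge> 1" using t by simp
    have r: "sqrt (real t) \<le> real r" "real r \<le> 2 * sqrt (real t)"
      using st unfolding r_def by linarith+
    have "real r > 0" using r(1) st by linarith
    then have r0: "r > 0" by simp
    have "real t \<le> (real r)\<^sup>2"
      using power_mono[OF r(1), of 2] by simp
    then have "A * real t \<le> (real M)\<^sup>2 * (real r)\<^sup>2"
      using M by (intro mult_mono) auto
    then have low: "profile j t (int (j + M * r)) \<le> - 1 / 2"
      using M r0 by (intro profile_lower) (auto simp: A_def power_mult_distrib)
    define w where "w = site_weight N (j + M * r)"
    have pos: "j + M * r > 0" using M(2) r0 by auto
    have "w > 0" using site_weight_ge(3)[OF pos] by (simp add: w_def)
    have "w \<le> 1 + 2 * N * (real j + real M * real r)"
      using N by (simp add: w_def site_weight_def algebra_simps)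
    also have "\<dots> \<le> D * real r"
    proof -
      have "1 \<le> real r" using r(1) st by linarith
      moreover from this have "real j * 1 \<le> real j * real r" by (intro mult_left_mono) auto
      ultimately have "2 * N * (real j + real M * real r) \<le> 2 * N * ((real j + real M) * real r)" "1 \<le> real r"
        using N by (auto simp: distrib_right intro!: mult_left_mono)
      then show ?thesis by (simp add: D_def algebra_simps)
    qed
    also have "\<dots> \<le> D * (2 * sqrt (real t))" using r D by (intro mult_left_mono) auto
    finally have w: "w \<le> D * (2 * sqrt (real t))" .
    have "1 / (8 * D) / sqrt (real t) = 1 / 2 / (D * (2 * sqrt (real t))) / 2" by simp
    also have "\<dots> \<le> 1 / 2 / w / 2"
      using w \<open>w > 0\<close> by (intro divide_right_mono divide_left_mono) auto
    also have "\<dots> \<le> \<bar>excess_tail N (profile j t) (j + M * r)\<bar> / 2"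
    proof -
      have "1 / 2 / w \<le> \<bar>profile j t (int (j + M * r))\<bar> / w"
        using low \<open>w > 0\<close> by (intro divide_right_mono) linarith+
      moreover have "\<bar>excess_tail N f n\<bar> = \<bar>f (int n)\<bar> / site_weight N n" if "n > 0" for f n
        using that site_weight_ge(3)[of n] by (simp add: excess_tail_def)
      ultimately show ?thesis using pos by (simp add: w_def)
    qed
    also have "\<dots> \<le> tv_dist (stat_mass N) (walk_dist (walk_op N l) j t)"
      by (rule excess_tail_le_tv)
    finally show ?thesis .
  qed
  moreover have "1 / (8 * D) > 0" using D by simp
  ultimately show thesis using that by blast
qed

section \<open>The upper bound\<close>

lemma profile_bounds:
  obtains C where "C > 0"
    "\<And>t n. t > 0 \<Longrightarrow> \<bar>profile j t n - profile j t (n - 1)\<bar>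
       \<le> C / sqrt (real t)"
    "\<And>t n. t > 0 \<Longrightarrow> \<bar>profile j t (int n + 1)\<bar>
       \<le> (real n + 1) * (C / sqrt (real t))"
proof -
  \<comment> \<open>The profile is 1 up to \<open>- j\<close> and -1 to the right of
    \<open>j\<close>.\<close>
  have "initial_profile N j n - initial_profile N j (n - 1) = 0" if "n \<notin> {- int j..int j + 1}" for n
    using that by (auto simp: initial_profile_def)
  then obtain C where C: "C > 0" "\<And>t n. t > 0 \<Longrightarrow>
      \<bar>(heat k ^^ t) (\<lambda>n. initial_profile N j n - initial_profile N j (n - 1)) n\<bar> \<le> C / sqrt (real t)"
    using funpow_heat_sup_bound[OF rate, of "{- int j..int j + 1}"
        "\<lambda>n. initial_profile N j n - initial_profile N j (n - 1)"] by auto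
  have D: "\<bar>profile j t n - profile j t (n - 1)\<bar>
       \<le> C / sqrt (real t)" if "t > 0" for t n
    using C(2)[OF that] by (simp add: funpow_heat_diff)
  have "\<bar>profile j t (int n + 1)\<bar>
       \<le> (real n + 1) * (C / sqrt (real t))"
    if "t > 0" for t n
  proof (induction n)
    case 0
    \<comment> \<open>By antisymmetry the increment at 1 is twice the value there.\<close>
    show ?case using D[OF that, of 1] profile_antisym[of t j] by simp
  next
    case (Suc n)
    define q where "q = C / sqrt (real t)"
    have "int (Suc n) + 1 = int n + 2" "int n + 2 - 1 = int n + 1"
        "(real (Suc n) + 1) * q = (real n + 1) * q + q"
      by (simp_all add: algebra_simps)
    then show ?case
      using D[OF that, of "int n + 2"] Suc unfolding q_def[symmetric]
      by (simp only:)
  qed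
  with C(1) D show thesis using that by blast
qed

lemma tv_upper:
  obtains C where "C > 0" "\<And>t. t \<ge> j + 3 \<Longrightarrow>
    tv_dist (stat_mass N) (walk_dist (walk_op N l) j t) \<le> C * (ln (real t) / sqrt (real t))"
proof -
  obtain K where K: "K > 0"
    "\<And>t n. t > 0 \<Longrightarrow> \<bar>profile j t n - profile j t (n - 1)\<bar>
       \<le> K / sqrt (real t)"
    "\<And>t n. t > 0 \<Longrightarrow> \<bar>profile j t (int n + 1)\<bar>
       \<le> (real n + 1) * (K / sqrt (real t))"
    using profile_bounds[of j] by metis
  define D where "D = 4 * K / N"
  have D: "D > 0" using K(1) N by (simp add: D_def)
  have "tv_dist (stat_mass N) (walk_dist (walk_op N l) j t) \<le>
      (1 / N + 3 * D) * (ln (real t) / sqrt (real t))" if t: "t \<ge> j + 3" for t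
  proof -
    define s where "s = profile j t"
    define q where "q = K / sqrt (real t)"
    have t0: "t > 0" using t by simp
    have q: "q > 0" using K(1) t0 by (simp add: q_def)
    have d: "\<bar>stat_mass N n - walk_dist (walk_op N l) j t n\<bar> \<le> D / sqrt (real t) * (1 / real (Suc n))" for n
    proof (cases n)
      case 0
      have "\<bar>s 1\<bar> \<le> q" using K(3)[OF t0, of 0] by (simp add: s_def q_def)
      then have "\<bar>s 1\<bar> / (1 + N) \<le> q / (1 + N)" using N by (intro divide_right_mono) auto
      also have "\<dots> \<le> q / N" using q N by (intro divide_left_mono) auto
      also have "\<dots> \<le> 4 * q / N" using q N by (intro divide_right_mono) auto
      finally show ?thesis using 0 N
        by (simp add: walk_dist_eq_excess excess_tail_def s_def site_weight_def D_def q_def mult_ac)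
    next
      case (Suc m)
      define a where "a = site_weight N n"
      define x y where "x = s (int n)" and "y = s (int n + 1)"
      have a: "a > 0" "N * real n \<le> a"
        using site_weight_ge[of n] Suc by (auto simp: a_def)
      have x: "\<bar>x\<bar> \<le> real n * q" and y: "\<bar>y - x\<bar> \<le> q"
        using K(3)[OF t0, of m] K(2)[OF t0, of "int n + 1"] Suc
        by (auto simp: x_def y_def s_def q_def add.commute)
      \<comment> \<open>The first term comes from the change of weight, the second from the
        increment of the profile; \<open>N * n \<le> a\<close> brings the first to the same
        order.\<close>
      have "\<bar>x / a - y / (a + 2 * N)\<bar> = \<bar>x * (2 * N) / (a * (a + 2 * N)) - (y - x) / (a + 2 * N)\<bar>"
        using a N by (simp add: divide_simps) (simp add: algebra_simps)
      also have "\<dots> \<le> \<bar>x\<bar> * (2 * N) / (a * (a + 2 * N)) + \<bar>y - x\<bar> / (a + 2 * N)"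
        using a N by (intro order_trans[OF abs_triangle_ineq4]) (simp add: abs_mult)
      also have "\<dots> \<le> (real n * q) * (2 * N) / (a * (a + 2 * N)) + q / (a + 2 * N)"
        using a N x y by (intro add_mono divide_right_mono mult_right_mono) auto
      also have "(real n * q) * (2 * N) / (a * (a + 2 * N)) \<le> a * (2 * q) / (a * (a + 2 * N))"
        using a N q mult_right_mono[OF a(2), of "2 * q"] by (intro divide_right_mono) (auto simp: mult_ac)
      also have "\<dots> + q / (a + 2 * N) = 3 * q / (a + 2 * N)"
        using a N by (simp add: divide_simps)
      also have "\<dots> \<le> 4 * q / (N * real (Suc n))"
        using a N q by (intro frac_le) (auto simp: algebra_simps add_pos_nonneg)
      finally show ?thesis
        using Suc by (simp add: walk_dist_eq_excess excess_tail_def s_def[symmetric] D_def q_def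
            x_def y_def a_def site_weight_Suc mult_ac add_ac)
    qed
    \<comment> \<open>Follows from \<open>exp 1 \<le> 3 \<le> t\<close> and lets the logarithm
      absorb constants.\<close>
    have lnt: "ln (real t) \<ge> 1"
    proof -
      have "exp 1 \<le> real t" using exp_le t by linarith
      then show ?thesis using t0 by (simp add: ln_ge_iff)
    qed
    define m where "m = t + j + 1"
    have "(\<Sum>n<m. \<bar>stat_mass N n - walk_dist (walk_op N l) j t n\<bar>) \<le>
        (\<Sum>n<m. D / sqrt (real t) * (1 / real (Suc n)))"
      by (intro sum_mono d)
    also have "\<dots> = D / sqrt (real t) * harm m"
      by (simp add: harm_def sum_distrib_left[symmetric] sum.atLeast1_atMost_eq divide_inverse)
    also have "\<dots> \<le> D / sqrt (real t) * (3 * ln (real t))"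
    proof (intro mult_left_mono)
      \<comment> \<open>\<open>harm m - ln m\<close> decreases from 1, and
        \<open>m \<le> t\<^sup>2\<close> gives \<open>ln m \<le> 2 * ln t\<close>; together with
        \<open>1 \<le> ln t\<close> this yields the factor 3.\<close>
      have "harm m - ln (real m) \<le> harm 1 - ln (real 1)"
        using euler_mascheroni_sequence_decreasing[of 1 m] by (simp add: m_def)
      moreover have "ln (real m) \<le> ln ((real t)\<^sup>2)"
      proof -
        have "m \<le> 2 * t" using t by (simp add: m_def)
        also have "2 * t \<le> t * t" using t by (intro mult_right_mono) auto
        finally have "real m \<le> (real t)\<^sup>2"
          by (metis of_nat_le_iff of_nat_mult power2_eq_square)
        then show ?thesis by (intro ln_mono) (auto simp: m_def)
      qed
      moreover have "ln ((real t)\<^sup>2) = 2 * ln (real t)" using t0 by (simp add: ln_realpow)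
      moreover have "harm 1 = (1::real)" by (simp add: harm_def)
      ultimately show "harm m \<le> 3 * ln (real t)" using lnt by simp
    qed (use D in auto)
    finally have sum: "(\<Sum>n<m. \<bar>stat_mass N n - walk_dist (walk_op N l) j t n\<bar>) \<le>
      3 * D * (ln (real t) / sqrt (real t))" by (simp add: mult_ac)
    have "stat_tail N m \<le> 1 / (N * real m)"
      using site_weight_ge[of m] N by (auto simp: stat_tail_def m_def intro!: divide_left_mono)
    also have "\<dots> \<le> 1 / (N * sqrt (real t))"
    proof -
      have "sqrt (real t) * 1 \<le> sqrt (real t) * sqrt (real t)"
        using t0 by (intro mult_left_mono) auto
      then have "sqrt (real t) \<le> real t" by simp
      also have "\<dots> \<le> real m" by (simp add: m_def)
      finally show ?thesis using N t0 by (intro divide_left_mono mult_left_mono) (auto simp: m_def)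
    qed
    also have "\<dots> \<le> ln (real t) / (N * sqrt (real t))"
      using lnt N by (intro divide_right_mono) auto
    finally have tail: "stat_tail N m \<le> 1 / N * (ln (real t) / sqrt (real t))" by simp
    have "1 / 2 * (stat_tail N m + (\<Sum>n<m. \<bar>stat_mass N n - walk_dist (walk_op N l) j t n\<bar>)) \<le>
        1 * (1 / N * (ln (real t) / sqrt (real t)) + 3 * D * (ln (real t) / sqrt (real t)))"
      using N by (intro mult_mono add_mono tail sum add_nonneg_nonneg sum_nonneg)
        (use site_weight_ge[of m] D lnt in \<open>auto simp: stat_tail_def m_def\<close>)
    then show ?thesis
      unfolding tv_dist_eq m_def[symmetric] by (simp only: distrib_right mult_1_left)
  qed
  moreover have "1 / N + 3 * D > 0" using N D by (intro add_pos_pos) auto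
  ultimately show thesis using that by blast
qed

end

theorem theorem2:
  fixes N l :: real
  assumes "N > 0"
    and "l \<ge> 2 * N\<^sup>2 / ((1 + N) * (1 + 3 * N))"
  shows "(\<exists>!\<nu>. stationary (walk_op N l) \<nu>) \<and>
    (\<forall>\<nu>. stationary (walk_op N l) \<nu> \<longrightarrow>
      (\<forall>j. \<exists>c > 0. \<exists>C > 0. \<forall>\<^sub>F t in sequentially.
         c / sqrt (real t) \<le> tv_dist (pmf \<nu>) (walk_dist (walk_op N l) j t) \<and>
         tv_dist (pmf \<nu>) (walk_dist (walk_op N l) j t) \<le> C * (ln (real t) / sqrt (real t))))"
proof -
  \<comment> \<open>Positivity of \<open>l\<close> puts the jump rate strictly below 1/2, as the
    heat kernel bound requires.\<close>
  have "2 * N\<^sup>2 / ((1 + N) * (1 + 3 * N)) > 0" using assms(1) by simp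
  with assms(2) have l: "l > 0" by linarith
  have "\<exists>c > 0. \<exists>C > 0. \<forall>\<^sub>F t in sequentially.
         c / sqrt (real t) \<le> tv_dist (stat_mass N) (walk_dist (walk_op N l) j t) \<and>
         tv_dist (stat_mass N) (walk_dist (walk_op N l) j t) \<le> C * (ln (real t) / sqrt (real t))" for j
  proof -
    obtain c where c: "c > 0"
      "\<And>t. t > 0 \<Longrightarrow> c / sqrt (real t) \<le> tv_dist (stat_mass N) (walk_dist (walk_op N l) j t)"
      using tv_lower[OF assms(1) l, of j] by metis
    obtain C where C: "C > 0" "\<And>t. t \<ge> j + 3 \<Longrightarrow>
      tv_dist (stat_mass N) (walk_dist (walk_op N l) j t) \<le> C * (ln (real t) / sqrt (real t))"
      using tv_upper[OF assms(1) l, of j] by metis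
    have "\<forall>\<^sub>F t in sequentially.
         c / sqrt (real t) \<le> tv_dist (stat_mass N) (walk_dist (walk_op N l) j t) \<and>
         tv_dist (stat_mass N) (walk_dist (walk_op N l) j t) \<le> C * (ln (real t) / sqrt (real t))"
      using eventually_ge_at_top[of "j + 3"] by eventually_elim (use c C in auto)
    then show ?thesis using c(1) C(1) by blast
  qed
  then show ?thesis
    using stationary_unique_exists[OF assms(1) l] stationary_iff[OF assms(1) l] by simp
qed

end
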